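(* Let $\Lambda$ be a finite, singly connected, edge-level non-degenerate $k$-graph with at least one edge. Then there is a vertex $v_0\in\Lambda^0$ with $\mathsf{E}(v_0)=\{1,\dots,k\}$.
   Context: Let $\mathbb{N}^k$ be the free abelian monoid with generators $\varepsilon_1,\dots,\varepsilon_k$ (with $0\in\mathbb{N}$). A $k$-graph is a countable category $\Lambda$ together with a functor $d\colon\Lambda\to\mathbb{N}^k$ satisfying the factorisation property: whenever $d(\lambda)=m+n$ there exist unique $\mu,\nu\in\Lambda$ with $d(\mu)=m$, $d(\nu)=n$ and $\lambda=\mu\nu$. Elements of $\Lambda$ are morphisms; $\mathrm{r},\mathrm{s}\colon\Lambda\to\Lambda^0$ are the range and source maps; $\Lambda^m:=d^{-1}(m)$, and $\Lambda^0=d^{-1}(0)$ is identified with the set of objects (vertices). The composite $\mu\nu$ is defined when $\mathrm{s}(\mu)=\mathrm{r}(\nu)$, and then $\mathrm{r}(\mu\nu)=\mathrm{r}(\mu)$, $\mathrm{s}(\mu\nu)=\mathrm{s}(\nu)$. Elements of $\Lambda^{\varepsilon_i}$ are edges of colour $i$; an edge is an element of $\bigcup_{i\le k}\Lambda^{\varepsilon_i}$. For $u,v\in\Lambda^0$ and $F\subseteq\Lambda$: $uF=\mathrm{r}^{-1}(u)\cap F$, $Fv=\mathrm{s}^{-1}(v)\cap F$, and $u\Lambda v=\mathrm{r}^{-1}(u)\cap\mathrm{s}^{-1}(v)$. Finite: $\Lambda^0$ is finite. Singly connected: $|u\Lambda v|\le 1$ for all $u,v\in\Lambda^0$. For $v\in\Lambda^0$,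 $\mathsf{E}(v)=\{i\in\{1,\dots,k\}: v\Lambda^{\varepsilon_i}\neq\emptyset\}$, the set of colours $i$ for which there is a colour-$i$ edge with range $v$ (the colours emitted by $v$). Commuting $(i,j)$-square ($i\neq j$): an element $\lambda\in\Lambda^{\varepsilon_i+\varepsilon_j}$ presented through its two factorisations $\lambda=\mu\nu=\nu'\mu'$ with $d(\mu)=d(\mu')=\varepsilon_i$ and $d(\nu)=d(\nu')=\varepsilon_j$. An edge $e$ lies in the square if $e\in\{\mu,\nu,\nu',\mu'\}$. $\Lambda$ is edge-level non-degenerate if for every colour $i\in\{1,\dots,k\}$, every $e\in\Lambda^{\varepsilon_i}$, and every $j\neq i$, the edge $e$ lies in some commuting $(i,j)$-square. *)

theory Defs
  imports "HOL-Library.Poly_Mapping" "HOL-Library.Countable_Set"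
begin

text \<open>
  A small category is given by its morphisms alone: an object is identified with the
  identity morphism at it, so the range and source maps take values in morphisms.
  Composition is a total function whose value is meaningful only on composable pairs.
\<close>

record ('a, 'd) graded_category =
  Mor :: "'a set"
  rng :: "'a \<Rightarrow> 'a"
  src :: "'a \<Rightarrow> 'a"
  cmp :: "'a \<Rightarrow> 'a \<Rightarrow> 'a"  (infixl "\<cdot>\<index>" 70)
  deg :: "'a \<Rightarrow> 'd"

locale small_category =
  fixes \<Lambda> :: "('a, 'd, 'm) graded_category_scheme" (structure)
  assumes rng_closed: "x \<in> Mor \<Lambda> \<Longrightarrow> rng \<Lambda> x \<in> Mor \<Lambda>"
    and src_closed: "x \<in> Mor \<Lambda> \<Longrightarrow> src \<Lambda> x \<in> Mor \<Lambda>"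
    and rng_rng: "x \<in> Mor \<Lambda> \<Longrightarrow> rng \<Lambda> (rng \<Lambda> x) = rng \<Lambda> x"
    and src_rng: "x \<in> Mor \<Lambda> \<Longrightarrow> src \<Lambda> (rng \<Lambda> x) = rng \<Lambda> x"
    and rng_src: "x \<in> Mor \<Lambda> \<Longrightarrow> rng \<Lambda> (src \<Lambda> x) = src \<Lambda> x"
    and src_src: "x \<in> Mor \<Lambda> \<Longrightarrow> src \<Lambda> (src \<Lambda> x) = src \<Lambda> x"
    and cmp_closed:
      "\<lbrakk>x \<in> Mor \<Lambda>; y \<in> Mor \<Lambda>; src \<Lambda> x = rng \<Lambda> y\<rbrakk> \<Longrightarrow> x \<cdot> y \<in> Mor \<Lambda>"
    and rng_cmp:
      "\<lbrakk>x \<in> Mor \<Lambda>; y \<in> Mor \<Lambda>; src \<Lambda> x = rng \<Lambda> y\<rbrakk> \<Longrightarrow> rng \<Lambda> (x \<cdot> y) = rng \<Lambda> x"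
    and src_cmp:
      "\<lbrakk>x \<in> Mor \<Lambda>; y \<in> Mor \<Lambda>; src \<Lambda> x = rng \<Lambda> y\<rbrakk> \<Longrightarrow> src \<Lambda> (x \<cdot> y) = src \<Lambda> y"
    and cmp_assoc:
      "\<lbrakk>x \<in> Mor \<Lambda>; y \<in> Mor \<Lambda>; z \<in> Mor \<Lambda>; src \<Lambda> x = rng \<Lambda> y; src \<Lambda> y = rng \<Lambda> z\<rbrakk>
        \<Longrightarrow> (x \<cdot> y) \<cdot> z = x \<cdot> (y \<cdot> z)"
    and rng_cmp_left: "x \<in> Mor \<Lambda> \<Longrightarrow> rng \<Lambda> x \<cdot> x = x"
    and cmp_src_right: "x \<in> Mor \<Lambda> \<Longrightarrow> x \<cdot> src \<Lambda> x = x"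

text \<open>
  The monoid \<open>\<nat>\<^sup>k\<close> is realised inside the finitely supported functions on \<^typ>\<open>nat\<close>
  as those supported in \<open>{1..k}\<close>.
\<close>

type_synonym multidegree = "nat \<Rightarrow>\<^sub>0 nat"

definition Nk :: "nat \<Rightarrow> multidegree set" where
  "Nk k = {m. Poly_Mapping.keys m \<subseteq> {1..k}}"

definition gen :: "nat \<Rightarrow> multidegree"  ("\<epsilon>") where
  "\<epsilon> i = Poly_Mapping.single i 1"

locale k_graph = small_category \<Lambda>
  for k :: nat and \<Lambda> :: "('a, multidegree, 'm) graded_category_scheme" (structure) +
  assumes countable_Mor: "countable (Mor \<Lambda>)"
    and deg_closed: "x \<in> Mor \<Lambda> \<Longrightarrow> deg \<Lambda> x \<in> Nk k"
    and deg_rng: "x \<in> Mor \<Lambda> \<Longrightarrow> deg \<Lambda> (rng \<Lambda> x) = 0"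
    and deg_src: "x \<in> Mor \<Lambda> \<Longrightarrow> deg \<Lambda> (src \<Lambda> x) = 0"
    and deg_cmp:
      "\<lbrakk>x \<in> Mor \<Lambda>; y \<in> Mor \<Lambda>; src \<Lambda> x = rng \<Lambda> y\<rbrakk>
        \<Longrightarrow> deg \<Lambda> (x \<cdot> y) = deg \<Lambda> x + deg \<Lambda> y"
    and factorisation:
      "\<lbrakk>x \<in> Mor \<Lambda>; m \<in> Nk k; n \<in> Nk k; deg \<Lambda> x = m + n\<rbrakk>
        \<Longrightarrow> \<exists>!(\<mu>, \<nu>). \<mu> \<in> Mor \<Lambda> \<and> \<nu> \<in> Mor \<Lambda> \<and> deg \<Lambda> \<mu> = m \<and> deg \<Lambda> \<nu> = n \<and>
              src \<Lambda> \<mu> = rng \<Lambda> \<nu> \<and> x = \<mu> \<cdot> \<nu>"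

definition of_degree ::
  "('a, multidegree, 'm) graded_category_scheme \<Rightarrow> multidegree \<Rightarrow> 'a set" where
  "of_degree \<Lambda> m = {x \<in> Mor \<Lambda>. deg \<Lambda> x = m}"

abbreviation vertices :: "('a, multidegree, 'm) graded_category_scheme \<Rightarrow> 'a set" where
  "vertices \<Lambda> \<equiv> of_degree \<Lambda> 0"

text \<open>The elements of degree 0 are exactly the identity morphisms, i.e. the objects.\<close>

lemma (in k_graph) vertices_eq_identities: "vertices \<Lambda> = {x \<in> Mor \<Lambda>. rng \<Lambda> x = x}"
proof (intro equalityI subsetI)
  fix x assume "x \<in> vertices \<Lambda>"
  then have x: "x \<in> Mor \<Lambda>" and d: "deg \<Lambda> x = 0" by (auto simp: of_degree_def)
  let ?P = "\<lambda>p. case p of (\<mu>, \<nu>) \<Rightarrow> \<mu> \<in> Mor \<Lambda> \<and> \<nu> \<in> Mor \<Lambda> \<and> deg \<Lambda> \<mu> = 0 \<and>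
    deg \<Lambda> \<nu> = 0 \<and> src \<Lambda> \<mu> = rng \<Lambda> \<nu> \<and> x = \<mu> \<cdot> \<nu>"
  have ex1: "\<exists>!p. ?P p"
    using factorisation[OF x, of 0 0] d by (simp add: Nk_def)
  have 1: "?P (rng \<Lambda> x, x)"
    using x d by (simp add: rng_closed deg_rng src_rng rng_cmp_left)
  have 2: "?P (x, src \<Lambda> x)"
    using x d by (simp add: src_closed deg_src rng_src cmp_src_right)
  from ex1 1 2 have "(rng \<Lambda> x, x) = (x, src \<Lambda> x)" by blast
  then show "x \<in> {x \<in> Mor \<Lambda>. rng \<Lambda> x = x}" using x by simp
next
  fix x assume "x \<in> {x \<in> Mor \<Lambda>. rng \<Lambda> x = x}"
  then show "x \<in> vertices \<Lambda>" using deg_rng[of x] by (simp add: of_degree_def)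
qed

definition edges ::
  "nat \<Rightarrow> ('a, multidegree, 'm) graded_category_scheme \<Rightarrow> 'a set" where
  "edges k \<Lambda> = (\<Union>i\<in>{1..k}. of_degree \<Lambda> (\<epsilon> i))"

definition finite_graph :: "('a, multidegree, 'm) graded_category_scheme \<Rightarrow> bool" where
  "finite_graph \<Lambda> \<longleftrightarrow> finite (vertices \<Lambda>)"

definition hom_between ::
  "('a, multidegree, 'm) graded_category_scheme \<Rightarrow> 'a \<Rightarrow> 'a \<Rightarrow> 'a set" where
  "hom_between \<Lambda> u v = {x \<in> Mor \<Lambda>. rng \<Lambda> x = u \<and> src \<Lambda> x = v}"

text \<open>The finiteness conjunct is needed because \<^const>\<open>card\<close> is 0 on infinite sets.\<close>

definition singly_connected :: "('a, multidegree, 'm) graded_category_scheme \<Rightarrow> bool" where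
  "singly_connected \<Lambda> \<longleftrightarrow>
    (\<forall>u\<in>vertices \<Lambda>. \<forall>v\<in>vertices \<Lambda>.
      finite (hom_between \<Lambda> u v) \<and> card (hom_between \<Lambda> u v) \<le> 1)"

definition emitted_colours ::
  "nat \<Rightarrow> ('a, multidegree, 'm) graded_category_scheme \<Rightarrow> 'a \<Rightarrow> nat set" where
  "emitted_colours k \<Lambda> v = {i \<in> {1..k}. {e \<in> of_degree \<Lambda> (\<epsilon> i). rng \<Lambda> e = v} \<noteq> {}}"

text \<open>
  \<open>commuting_square \<Lambda> i j x \<mu> \<nu> \<nu>' \<mu>'\<close>: the element \<open>x\<close> of degree \<open>\<epsilon> i + \<epsilon> j\<close>
  together with its two factorisations \<open>x = \<mu>\<nu> = \<nu>'\<mu>'\<close>, where \<open>\<mu>, \<mu>'\<close> have colour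
  \<open>i\<close> and \<open>\<nu>, \<nu>'\<close> have colour \<open>j\<close>.
\<close>

definition commuting_square ::
  "('a, multidegree, 'm) graded_category_scheme \<Rightarrow> nat \<Rightarrow> nat \<Rightarrow>
    'a \<Rightarrow> 'a \<Rightarrow> 'a \<Rightarrow> 'a \<Rightarrow> 'a \<Rightarrow> bool" where
  "commuting_square \<Lambda> i j x \<mu> \<nu> \<nu>' \<mu>' \<longleftrightarrow>
    i \<noteq> j \<and> x \<in> of_degree \<Lambda> (\<epsilon> i + \<epsilon> j) \<and>
    \<mu> \<in> of_degree \<Lambda> (\<epsilon> i) \<and> \<mu>' \<in> of_degree \<Lambda> (\<epsilon> i) \<and>
    \<nu> \<in> of_degree \<Lambda> (\<epsilon> j) \<and> \<nu>' \<in> of_degree \<Lambda> (\<epsilon> j) \<and>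
    src \<Lambda> \<mu> = rng \<Lambda> \<nu> \<and> x = cmp \<Lambda> \<mu> \<nu> \<and>
    src \<Lambda> \<nu>' = rng \<Lambda> \<mu>' \<and> x = cmp \<Lambda> \<nu>' \<mu>'"

definition edge_level_nondegenerate ::
  "nat \<Rightarrow> ('a, multidegree, 'm) graded_category_scheme \<Rightarrow> bool" where
  "edge_level_nondegenerate k \<Lambda> \<longleftrightarrow>
    (\<forall>i\<in>{1..k}. \<forall>e\<in>of_degree \<Lambda> (\<epsilon> i). \<forall>j\<in>{1..k}. j \<noteq> i \<longrightarrow>
      (\<exists>x \<mu> \<nu> \<nu>' \<mu>'. commuting_square \<Lambda> i j x \<mu> \<nu> \<nu>' \<mu>' \<and> e \<in> {\<mu>, \<nu>, \<nu>', \<mu>'}))"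

end

theory Submission
  imports Defs
begin

text \<open>
  In a singly connected \<open>k\<close>-graph a loop of nonzero degree at \<open>v\<close> would be a second element
  of \<open>v\<Lambda>v\<close> besides the vertex \<open>v\<close>, so there are no cycles. By finiteness one can therefore
  start from any edge and prepend edges until reaching an edge \<open>e\<close> whose range \<open>v\<^sub>0\<close> is the
  source of no edge (\<open>exists_edge_with_initial_range\<close>). Such a \<open>v\<^sub>0\<close> emits every colour
  (\<open>emitted_colours_initial_range\<close>): let \<open>e\<close> have colour \<open>i\<close>, and let \<open>j \<noteq> i\<close>. In a commuting
  \<open>(i, j)\<close>-square \<open>\<mu>\<nu> = \<nu>'\<mu>'\<close> containing \<open>e\<close>, the edges \<open>\<nu>\<close> and \<open>\<nu>'\<close> have the wrong colour
  to be \<open>e\<close>, and \<open>e = \<mu>'\<close> is excluded because \<open>\<nu>'\<close> would be an edge with source \<open>v\<^sub>0\<close>. Hence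
  \<open>e = \<mu>\<close>, and \<open>\<nu>'\<close> is an edge of colour \<open>j\<close> with range \<open>v\<^sub>0\<close>.
\<close>

lemma gen_eq_iff: "\<epsilon> i = \<epsilon> j \<longleftrightarrow> i = j"
  by (metis gen_def lookup_single_eq lookup_single_not_eq one_neq_zero)

lemma gen_neq_0: "\<epsilon> i \<noteq> 0"
  by (metis gen_def lookup_single_eq lookup_zero one_neq_zero)

lemma edgesE:
  assumes "e \<in> edges k \<Lambda>"
  obtains i where "i \<in> {1..k}" "e \<in> Mor \<Lambda>" "deg \<Lambda> e = \<epsilon> i"
  using assms by (auto simp: edges_def of_degree_def)

context k_graph
begin

lemma rng_in_vertices: "x \<in> Mor \<Lambda> \<Longrightarrow> rng \<Lambda> x \<in> vertices \<Lambda>"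
  by (simp add: of_degree_def rng_closed deg_rng)

lemma singly_connected_loop_deg_0:
  assumes "singly_connected \<Lambda>" "x \<in> Mor \<Lambda>" "src \<Lambda> x = rng \<Lambda> x"
  shows "deg \<Lambda> x = 0"
proof -
  let ?v = "rng \<Lambda> x"
  have "finite (hom_between \<Lambda> ?v ?v)" "card (hom_between \<Lambda> ?v ?v) \<le> 1"
    using assms(1) rng_in_vertices[OF assms(2)] by (auto simp: singly_connected_def)
  moreover have "x \<in> hom_between \<Lambda> ?v ?v" "?v \<in> hom_between \<Lambda> ?v ?v"
    using assms(2,3) by (auto simp: hom_between_def rng_closed rng_rng src_rng)
  ultimately have "x = ?v"
    by (metis One_nat_def card_le_Suc0_iff_eq)
  then show ?thesis
    using deg_rng[OF assms(2)] by simp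
qed

lemma exists_edge_with_initial_range:
  assumes fin: "finite_graph \<Lambda>" and sc: "singly_connected \<Lambda>" and ne: "edges k \<Lambda> \<noteq> {}"
  obtains e where "e \<in> edges k \<Lambda>" "\<And>f. f \<in> edges k \<Lambda> \<Longrightarrow> src \<Lambda> f \<noteq> rng \<Lambda> e"
proof -
  \<comment> \<open>The set of vertices \<open>w\<close> with \<open>w\<Lambda>v\<close> nonempty shrinks strictly whenever an edge is
     prepended, so an edge at whose range the cardinality of this set is
     least cannot be preceded by another.\<close>
  define D where "D v = {w \<in> vertices \<Lambda>. hom_between \<Lambda> w v \<noteq> {}}" for v
  have fin_D: "finite (D v)" for v
    using fin by (simp add: D_def finite_graph_def)
  obtain e where e: "e \<in> edges k \<Lambda>"
    and least: "\<And>f. f \<in> edges k \<Lambda> \<Longrightarrow> card (D (rng \<Lambda> e)) \<le> card (D (rng \<Lambda> f))"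
    using ne ex_has_least_nat[of "\<lambda>e. e \<in> edges k \<Lambda>" _ "\<lambda>e. card (D (rng \<Lambda> e))"] by blast
  have e_Mor: "e \<in> Mor \<Lambda>"
    using e by (rule edgesE)
  have "src \<Lambda> f \<noteq> rng \<Lambda> e" if f: "f \<in> edges k \<Lambda>" for f
  proof
    assume fe: "src \<Lambda> f = rng \<Lambda> e"
    obtain j where f_Mor: "f \<in> Mor \<Lambda>" and f_deg: "deg \<Lambda> f = \<epsilon> j"
      using f by (rule edgesE)
    have cmp_f: "g \<cdot> f \<in> Mor \<Lambda>" "rng \<Lambda> (g \<cdot> f) = rng \<Lambda> g" "src \<Lambda> (g \<cdot> f) = rng \<Lambda> e"
        "deg \<Lambda> (g \<cdot> f) = deg \<Lambda> g + \<epsilon> j"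
      if "g \<in> Mor \<Lambda>" "src \<Lambda> g = rng \<Lambda> f" for g
      using that f_Mor f_deg fe by (simp_all add: cmp_closed rng_cmp src_cmp deg_cmp)
    have "D (rng \<Lambda> f) \<subseteq> D (rng \<Lambda> e)"
      using cmp_f by (fastforce simp: D_def hom_between_def)
    moreover have "rng \<Lambda> e \<in> D (rng \<Lambda> e)"
      using e_Mor rng_in_vertices[OF e_Mor] rng_closed rng_rng src_rng
      unfolding D_def hom_between_def by blast
    moreover have "rng \<Lambda> e \<notin> D (rng \<Lambda> f)"
    proof
      assume "rng \<Lambda> e \<in> D (rng \<Lambda> f)"
      then obtain g where g: "g \<in> Mor \<Lambda>" "rng \<Lambda> g = rng \<Lambda> e" "src \<Lambda> g = rng \<Lambda> f"
        by (auto simp: D_def hom_between_def)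
      then have "deg \<Lambda> g + \<epsilon> j = 0"
        using singly_connected_loop_deg_0[OF sc, of "g \<cdot> f"] cmp_f[of g] by simp
      then show False
        by (metis add_eq_0_iff_both_eq_0 gen_neq_0 lookup_add lookup_zero poly_mapping_eqI)
    qed
    ultimately have "card (D (rng \<Lambda> f)) < card (D (rng \<Lambda> e))"
      using fin_D by (auto intro: psubset_card_mono)
    then show False
      using least[OF f] by simp
  qed
  with e that show thesis by blast
qed

lemma emitted_colours_initial_range:
  assumes nd: "edge_level_nondegenerate k \<Lambda>"
    and e: "e \<in> edges k \<Lambda>"
    and init: "\<And>f. f \<in> edges k \<Lambda> \<Longrightarrow> src \<Lambda> f \<noteq> rng \<Lambda> e"
  shows "emitted_colours k \<Lambda> (rng \<Lambda> e) = {1..k}"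
proof -
  obtain i where i: "i \<in> {1..k}" and e_Mor: "e \<in> Mor \<Lambda>" and e_deg: "deg \<Lambda> e = \<epsilon> i"
    using e by (rule edgesE)
  have "\<exists>f \<in> of_degree \<Lambda> (\<epsilon> j). rng \<Lambda> f = rng \<Lambda> e" if j: "j \<in> {1..k}" for j
  proof (cases "j = i")
    case True
    then show ?thesis using e_Mor e_deg by (auto simp: of_degree_def)
  next
    case False
    have "e \<in> of_degree \<Lambda> (\<epsilon> i)"
      using e_Mor e_deg by (simp add: of_degree_def)
    then obtain x \<mu> \<nu> \<nu>' \<mu>' where sq: "commuting_square \<Lambda> i j x \<mu> \<nu> \<nu>' \<mu>'"
      and mem: "e \<in> {\<mu>, \<nu>, \<nu>', \<mu>'}"
      using nd i j False unfolding edge_level_nondegenerate_def by metis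
    have Mor: "\<mu> \<in> Mor \<Lambda>" "\<nu> \<in> Mor \<Lambda>" "\<nu>' \<in> Mor \<Lambda>" "\<mu>' \<in> Mor \<Lambda>"
      and deg: "deg \<Lambda> \<nu> = \<epsilon> j" "deg \<Lambda> \<nu>' = \<epsilon> j"
      and comp: "src \<Lambda> \<mu> = rng \<Lambda> \<nu>" "src \<Lambda> \<nu>' = rng \<Lambda> \<mu>'" "\<mu> \<cdot> \<nu> = \<nu>' \<cdot> \<mu>'"
      using sq by (auto simp: commuting_square_def of_degree_def)
    have "e \<noteq> \<nu>" "e \<noteq> \<nu>'"
      using deg e_deg False gen_eq_iff by auto
    moreover have "\<nu>' \<in> edges k \<Lambda>"
      using Mor deg j by (auto simp: edges_def of_degree_def)
    then have "e \<noteq> \<mu>'"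
      using init comp by auto
    ultimately have "e = \<mu>"
      using mem by blast
    then have "rng \<Lambda> \<nu>' = rng \<Lambda> e"
      using Mor comp rng_cmp by metis
    then show ?thesis
      using Mor deg by (auto simp: of_degree_def)
  qed
  then show ?thesis
    unfolding emitted_colours_def by blast
qed

end

theorem proposition4p1:
  fixes k :: nat and \<Lambda> :: "('a, multidegree) graded_category"
  assumes "k_graph k \<Lambda>"
    and "finite_graph \<Lambda>"
    and "singly_connected \<Lambda>"
    and "edge_level_nondegenerate k \<Lambda>"
    and "edges k \<Lambda> \<noteq> {}"
  shows "\<exists>v\<^sub>0 \<in> vertices \<Lambda>. emitted_colours k \<Lambda> v\<^sub>0 = {1..k}"
proof -
  interpret k_graph k \<Lambda> by fact
  obtain e where e: "e \<in> edges k \<Lambda>" "\<And>f. f \<in> edges k \<Lambda> \<Longrightarrow> src \<Lambda> f \<noteq> rng \<Lambda> e"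
    using exists_edge_with_initial_range assms by blast
  have "e \<in> Mor \<Lambda>"
    using e(1) by (rule edgesE)
  then show ?thesis
    using emitted_colours_initial_range[OF assms(4) e] rng_in_vertices by blast
qed

end
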